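(* Let $g\in\mathbb{C}^N$ and let $m\le N$. Suppose that the collection $\{T_i g : 1\le i\le m\}$ is an orthonormal system in $\mathbb{C}^N$. Then there exists a subcollection $\{l_1,\dots,l_m\}$ of $m$ distinct indices in $\{1,\dots,N\}$ such that $|\widehat g(\lambda_{l_k})|>0$ for $k=1,\dots,m$. In addition, if this subcollection is unique (i.e. there is exactly one $m$-element subset $\{l_1,\dots,l_m\}$ of $\{1,\dots,N\}$ with this property), then $$|\widehat g(\lambda_{l_k})|=\frac{1}{\sqrt N\,\sqrt{\sum_{q=1}^m |\widehat{\delta_q}(\lambda_{l_k})|^2}},\qquad k=1,\dots,m.$$
   Context: Let $G$ be an undirected, connected, weighted graph with vertex set $\mathcal V=\{1,\dots,N\}$, and let $A$ be an $N\times N$ diagonalizable matrix associated with $G$ (for example its adjacency matrix or its graph Laplacian), with eigenvalues $\lambda_1,\dots,\lambda_N$ (listed with multiplicity) and corresponding eigenvectors $\chi_1,\dots,\chi_N$ forming an orthonormal basis of $\mathbb{C}^N$. A signal $f:\mathcal V\to\mathbb{C}$ is identified with the vector $(f(1),\dots,f(N))\in\mathbb{C}^N$. The graph Fourier transform of $f\in\mathbb{C}^N$ is $\widehat f(\lambda_l)=\sum_{n=1}^N f(n)\overline{\chi_l(n)}$, $l=1,\dots,N$ (indexed by $l$). The generalized convolution is $(f\ast g)(n)=\sum_{l=1}^N \widehat f(\lambda_l)\widehat g(\lambda_l)\chi_l(n)$. For $i=1,\dots,N$, $\delta_i\in\mathbb{C}^N$ is given by $\delta_i(n)=1$ if $n=i$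 and $0$ otherwise, and the generalized translation is $T_i f=\sqrt N\,(f\ast\delta_i)$. Collections such as $\{T_i g:1\le i\le m\}$ are regarded as families indexed by $i$ (so orthonormality means $\langle T_ig,T_jg\rangle=1$ if $i=j$ and $0$ if $i\neq j$). *)

theory Defs
  imports
    Complex_Main
    "Jordan_Normal_Form.Jordan_Normal_Form"
    "Jordan_Normal_Form.VS_Connect"
    "Jordan_Normal_Form.Conjugate"
    "Graph_Theory.Pair_Digraph"
    "Graph_Theory.Digraph_Component"
begin

text \<open>
  All indices are shifted down by one, following \<^typ>\<open>complex vec\<close> and \<^typ>\<open>complex mat\<close>:
  vertices, spectral indices and vector positions range over \<open>{0..<N}\<close> instead of
  \<open>{1,\<dots>,N}\<close>, and the indices \<open>1 \<le> i \<le> m\<close> become \<open>i \<in> {0..<m}\<close>. The vector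
  \<open>\<delta>\<^sub>i\<close> is \<^term>\<open>unit_vec N i\<close>.
\<close>

text \<open>
  Undirected graphs are symmetric digraphs; the two orientations of an edge carry the same weight.
  Neither loops nor signed weights are excluded.
\<close>

definition weighted_graph :: "nat \<Rightarrow> nat pair_pre_digraph \<Rightarrow> (nat \<times> nat \<Rightarrow> real) \<Rightarrow> bool" where
  "weighted_graph N G w \<longleftrightarrow>
     pair_pseudo_graph G \<and> pverts G = {0..<N} \<and>
     (\<forall>(u, v) \<in> parcs G. w (u, v) = w (v, u))"

definition diagonalizable :: "complex mat \<Rightarrow> bool" where
  "diagonalizable A \<longleftrightarrow> (\<exists>D. diagonal_mat D \<and> similar_mat A D)"

text \<open>
  Orthonormality of an indexed family, so repeated members are not identified. Since
  \<open>v \<bullet>c w\<close> is \<open>v \<bullet> conjugate w\<close>, the inner product is linear in its first argument.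
\<close>

definition orthonormal_family :: "nat \<Rightarrow> 'i set \<Rightarrow> ('i \<Rightarrow> complex vec) \<Rightarrow> bool" where
  "orthonormal_family N I v \<longleftrightarrow>
     (\<forall>i\<in>I. v i \<in> carrier_vec N) \<and>
     (\<forall>i\<in>I. \<forall>j\<in>I. v i \<bullet>c v j = (if i = j then 1 else 0))"

definition orthonormal_basis :: "nat \<Rightarrow> (nat \<Rightarrow> complex vec) \<Rightarrow> bool" where
  "orthonormal_basis N v \<longleftrightarrow>
     orthonormal_family N {0..<N} v \<and>
     vectorspace.basis class_ring (module_vec TYPE(complex) N) (v ` {0..<N})"

text \<open>
  The transform is a function of the index \<open>l\<close>, not of the value \<open>\<lambda>\<^sub>l\<close>, since
  eigenvalues may repeat.
\<close>

definition gft :: "(nat \<Rightarrow> complex vec) \<Rightarrow> complex vec \<Rightarrow> nat \<Rightarrow> complex" where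
  "gft \<chi> f l = (\<Sum>n = 0..<dim_vec f. f $ n * cnj (\<chi> l $ n))"

definition gconv :: "nat \<Rightarrow> (nat \<Rightarrow> complex vec) \<Rightarrow> complex vec \<Rightarrow> complex vec \<Rightarrow> complex vec" where
  "gconv N \<chi> f g = vec N (\<lambda>n. \<Sum>l = 0..<N. gft \<chi> f l * gft \<chi> g l * \<chi> l $ n)"

definition gtranslate :: "nat \<Rightarrow> (nat \<Rightarrow> complex vec) \<Rightarrow> nat \<Rightarrow> complex vec \<Rightarrow> complex vec" where
  "gtranslate N \<chi> i f = complex_of_real (sqrt (real N)) \<cdot>\<^sub>v gconv N \<chi> f (unit_vec N i)"

definition nonvanishing_subset ::
    "nat \<Rightarrow> (nat \<Rightarrow> complex vec) \<Rightarrow> complex vec \<Rightarrow> nat \<Rightarrow> nat set \<Rightarrow> bool" where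
  "nonvanishing_subset N \<chi> g m S \<longleftrightarrow>
     S \<subseteq> {0..<N} \<and> card S = m \<and> (\<forall>l\<in>S. cmod (gft \<chi> g l) > 0)"

end

theory Submission
  imports Defs
begin

text \<open>
  Since \<open>\<chi>\<close> is orthonormal, \<open>T\<^sub>i g\<close> has coefficients \<open>u\<^sub>i(l) = \<surd>N \<cdot> gft g l \<cdot> gft \<delta>\<^sub>i l\<close>, so the
  \<open>u\<^sub>i\<close>, \<open>i < m\<close>, are orthonormal and vanish off the support \<open>Z\<close> of the transform of \<open>g\<close>.
  By Bessel's inequality for the standard basis, \<open>\<Sum>\<^sub>i |u\<^sub>i(l)|\<^sup>2 \<le> 1\<close> for each \<open>l\<close>; summing over
  \<open>l \<in> Z\<close> gives \<open>m \<le> |Z|\<close>. Uniqueness of the subset forces \<open>|Z| = m\<close> (unless \<open>m = 0\<close>), and then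
  Bessel's inequality is an equality at every \<open>l \<in> Z\<close>, which is the stated formula.
\<close>

text \<open>Expanding the product and summing over \<open>L\<close> first leaves only the diagonal
  terms. It is used twice: in Bessel's inequality, and as Parseval's identity for the family
  \<open>\<chi>\<close>, where \<open>I\<close> holds the spectral indices and \<open>L\<close> the
  vertices.\<close>

lemma orthonormal_combination_inner:
  fixes u :: "'i \<Rightarrow> 'l \<Rightarrow> complex"
  assumes "finite I"
    and "\<And>i j. i \<in> I \<Longrightarrow> j \<in> I \<Longrightarrow> (\<Sum>l\<in>L. u i l * cnj (u j l)) = (if i = j then 1 else 0)"
  shows "(\<Sum>l\<in>L. (\<Sum>i\<in>I. c i * u i l) * cnj (\<Sum>i\<in>I. d i * u i l)) = (\<Sum>i\<in>I. c i * cnj (d i))"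
proof -
  have "(\<Sum>l\<in>L. (\<Sum>i\<in>I. c i * u i l) * cnj (\<Sum>i\<in>I. d i * u i l)) =
        (\<Sum>l\<in>L. \<Sum>i\<in>I. \<Sum>j\<in>I. c i * cnj (d j) * (u i l * cnj (u j l)))"
    by (simp add: sum_product mult_ac)
  also have "\<dots> = (\<Sum>i\<in>I. \<Sum>l\<in>L. \<Sum>j\<in>I. c i * cnj (d j) * (u i l * cnj (u j l)))"
    by (rule sum.swap)
  also have "\<dots> = (\<Sum>i\<in>I. \<Sum>j\<in>I. \<Sum>l\<in>L. c i * cnj (d j) * (u i l * cnj (u j l)))"
    by (rule sum.cong[OF refl], rule sum.swap)
  also have "\<dots> = (\<Sum>i\<in>I. \<Sum>j\<in>I. c i * cnj (d j) * (if i = j then 1 else 0))"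
    by (simp add: sum_distrib_left[symmetric] assms(2))
  also have "\<dots> = (\<Sum>i\<in>I. c i * cnj (d i))"
    using assms(1) by (simp add: if_distrib cong: if_cong)
  finally show ?thesis .
qed

text \<open>Bessel's inequality for the unit vector at \<open>k\<close>. Its orthogonal projection
  \<open>v\<close> onto the span of the \<open>u i\<close> has both squared norm and
  \<open>k\<close>-th coordinate equal to \<open>s\<close>, so s^2 is one term of a nonnegative sum
  with value \<open>s\<close>.\<close>

lemma bessel_coordinate:
  fixes u :: "'i \<Rightarrow> 'l \<Rightarrow> complex"
  assumes "finite I" "finite L" "k \<in> L"
    and "\<And>i j. i \<in> I \<Longrightarrow> j \<in> I \<Longrightarrow> (\<Sum>l\<in>L. u i l * cnj (u j l)) = (if i = j then 1 else 0)"
  shows "(\<Sum>i\<in>I. (cmod (u i k))\<^sup>2) \<le> 1"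
proof -
  define s where "s = (\<Sum>i\<in>I. (cmod (u i k))\<^sup>2)"
  define v where "v l = (\<Sum>i\<in>I. cnj (u i k) * u i l)" for l
  have vk: "v k = of_real s"
    unfolding v_def s_def of_real_sum by (simp only: complex_norm_square mult.commute)
  have "complex_of_real (\<Sum>l\<in>L. (cmod (v l))\<^sup>2) = (\<Sum>l\<in>L. v l * cnj (v l))"
    unfolding of_real_sum complex_norm_square ..
  also have "\<dots> = (\<Sum>i\<in>I. cnj (u i k) * cnj (cnj (u i k)))"
    unfolding v_def by (rule orthonormal_combination_inner[OF assms(1,4)])
  also have "\<dots> = v k"
    by (simp add: v_def)
  finally have norm_v: "(\<Sum>l\<in>L. (cmod (v l))\<^sup>2) = s"
    unfolding vk of_real_eq_iff .
  have "s\<^sup>2 = (cmod (v k))\<^sup>2"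
    by (simp add: vk)
  also have "\<dots> \<le> (\<Sum>l\<in>L. (cmod (v l))\<^sup>2)"
    using assms(2,3) by (intro member_le_sum) auto
  finally have "s * s \<le> 1 * s"
    unfolding norm_v by (simp add: power2_eq_square)
  moreover have "0 \<le> s"
    by (simp add: s_def sum_nonneg)
  \<comment> \<open>Cancel \<open>s\<close> if it is positive; the case s = 0 is trivial.\<close>
  ultimately have "s \<le> 1"
    by (metis mult_le_cancel_right_pos order_le_less zero_le_one)
  then show ?thesis
    by (simp add: s_def)
qed

lemma orthonormal_family_sum:
  assumes "orthonormal_family N I v" "i \<in> I" "j \<in> I"
  shows "(\<Sum>n = 0..<N. v i $ n * cnj (v j $ n)) = (if i = j then 1 else 0)"
proof -
  have "v i \<in> carrier_vec N" "v j \<in> carrier_vec N" "v i \<bullet>c v j = (if i = j then 1 else 0)"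
    using assms by (auto simp: orthonormal_family_def)
  then show ?thesis
    by (auto simp: scalar_prod_def)
qed

text \<open>Convolution multiplies coefficients, so this is Parseval's identity for two expansions
  in \<open>\<chi>\<close>. It moves the orthonormality of the translates to their coefficient
  vectors.\<close>

lemma gtranslate_inner:
  assumes "orthonormal_family N {0..<N} \<chi>"
  shows "gtranslate N \<chi> i f \<bullet>c gtranslate N \<chi> j g =
    (\<Sum>l = 0..<N. (sqrt (real N) * (gft \<chi> f l * gft \<chi> (unit_vec N i) l)) *
                  cnj (sqrt (real N) * (gft \<chi> g l * gft \<chi> (unit_vec N j) l)))"
proof -
  have nth: "gtranslate N \<chi> i f $ n =
      (\<Sum>l = 0..<N. (sqrt (real N) * (gft \<chi> f l * gft \<chi> (unit_vec N i) l)) * \<chi> l $ n)"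
    if "n < N" for i n f
    using that by (simp add: gtranslate_def gconv_def sum_distrib_left mult.assoc)
  have dim: "dim_vec (gtranslate N \<chi> i f) = N" for i f
    by (simp add: gtranslate_def gconv_def)
  have "gtranslate N \<chi> i f \<bullet>c gtranslate N \<chi> j g =
      (\<Sum>n = 0..<N. gtranslate N \<chi> i f $ n * cnj (gtranslate N \<chi> j g $ n))"
    by (simp add: scalar_prod_def dim)
  also have "\<dots> = (\<Sum>n = 0..<N.
      (\<Sum>l = 0..<N. (sqrt (real N) * (gft \<chi> f l * gft \<chi> (unit_vec N i) l)) * \<chi> l $ n) *
      cnj (\<Sum>l = 0..<N. (sqrt (real N) * (gft \<chi> g l * gft \<chi> (unit_vec N j) l)) * \<chi> l $ n))"
    by (rule sum.cong[OF refl]) (simp only: nth atLeastLessThan_iff)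
  also have "\<dots> = (\<Sum>l = 0..<N. (sqrt (real N) * (gft \<chi> f l * gft \<chi> (unit_vec N i) l)) *
      cnj (sqrt (real N) * (gft \<chi> g l * gft \<chi> (unit_vec N j) l)))"
    by (rule orthonormal_combination_inner[OF finite_atLeastLessThan
          orthonormal_family_sum[OF assms]])
  finally show ?thesis .
qed

text \<open>An exchange argument: replacing some \<open>x\<close> in \<open>S\<close> by some
  \<open>z\<close> in \<open>Z - S\<close> would give a second subset of the same size. The empty
  set must be excluded, as it is the only subset of size 0 of any \<open>Z\<close>.\<close>

lemma unique_subset_of_card:
  assumes "finite Z" "S \<subseteq> Z" "S \<noteq> {}"
    and unique: "\<And>S'. S' \<subseteq> Z \<Longrightarrow> card S' = card S \<Longrightarrow> S' = S"
  shows "S = Z"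
proof (rule ccontr)
  assume "S \<noteq> Z"
  then obtain z where z: "z \<in> Z" "z \<notin> S"
    using assms(2) by blast
  obtain x where x: "x \<in> S"
    using assms(3) by blast
  have "finite S"
    using assms(1,2) finite_subset by blast
  then have "card (insert z (S - {x})) = card S"
    using x z by (simp add: card_Suc_Diff1 del: card_Diff_insert)
  moreover have "insert z (S - {x}) \<subseteq> Z"
    using assms(2) z by blast
  ultimately have "insert z (S - {x}) = S"
    by (intro unique)
  with z show False
    by blast
qed

theorem theorem4p4:
  fixes N m :: nat
    and G :: "nat pair_pre_digraph" and w :: "nat \<times> nat \<Rightarrow> real"
    and A :: "complex mat" and ev :: "nat \<Rightarrow> complex"
    and \<chi> :: "nat \<Rightarrow> complex vec" and g :: "complex vec"
  assumes "weighted_graph N G w"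
    and "Digraph_Component.connected (with_proj G)"
    and "A \<in> carrier_mat N N"
    and "diagonalizable A"
    and "char_poly A = (\<Prod>l = 0..<N. [:- ev l, 1:])"
    and "\<forall>l \<in> {0..<N}. eigenvector A (\<chi> l) (ev l)"
    and "orthonormal_basis N \<chi>"
    and "g \<in> carrier_vec N"
    and "m \<le> N"
    and "orthonormal_family N {0..<m} (\<lambda>i. gtranslate N \<chi> i g)"
  shows "(\<exists>S. nonvanishing_subset N \<chi> g m S) \<and>
         ((\<exists>!S. nonvanishing_subset N \<chi> g m S) \<longrightarrow>
          (\<forall>S. nonvanishing_subset N \<chi> g m S \<longrightarrow>
            (\<forall>l\<in>S. cmod (gft \<chi> g l) =
               1 / (sqrt (real N) * sqrt (\<Sum>q = 0..<m. (cmod (gft \<chi> (unit_vec N q) l))\<^sup>2)))))"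
proof -
  define Z where "Z = {l \<in> {0..<N}. gft \<chi> g l \<noteq> 0}"
  define u where "u i l = sqrt (real N) * (gft \<chi> g l * gft \<chi> (unit_vec N i) l)" for i l
  define b where "b l = (\<Sum>i = 0..<m. (cmod (u i l))\<^sup>2)" for l
  have Z: "finite Z" "Z \<subseteq> {0..<N}"
    by (auto simp: Z_def)
  have nonvanishing_iff: "nonvanishing_subset N \<chi> g m S \<longleftrightarrow> S \<subseteq> Z \<and> card S = m" for S
    by (auto simp: nonvanishing_subset_def Z_def)
  have u_orth: "(\<Sum>l = 0..<N. u i l * cnj (u j l)) = (if i = j then 1 else 0)"
    if "i \<in> {0..<m}" "j \<in> {0..<m}" for i j
  proof -
    have "(\<Sum>l = 0..<N. u i l * cnj (u j l)) = gtranslate N \<chi> i g \<bullet>c gtranslate N \<chi> j g"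
      unfolding u_def
      by (rule gtranslate_inner[symmetric]) (use assms(7) in \<open>simp add: orthonormal_basis_def\<close>)
    also have "\<dots> = (if i = j then 1 else 0)"
      using assms(10) that unfolding orthonormal_family_def by blast
    finally show ?thesis .
  qed
  have b_le: "b l \<le> 1" if "l \<in> Z" for l
    unfolding b_def using that Z
    by (intro bessel_coordinate[OF _ finite_atLeastLessThan _ u_orth]) auto
  have "(\<Sum>l = 0..<N. (cmod (u i l))\<^sup>2) = 1" if "i \<in> {0..<m}" for i
  proof -
    have "complex_of_real (\<Sum>l = 0..<N. (cmod (u i l))\<^sup>2) = of_real 1"
      unfolding of_real_sum complex_norm_square using u_orth[OF that that] by simp
    then show ?thesis
      unfolding of_real_eq_iff .
  qed
  \<comment> \<open>Double counting: the \<open>m\<close> unit norms are regrouped by spectral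
    index, and the indices outside \<open>Z\<close> contribute nothing because \<open>u i l\<close>
    contains the factor \<open>gft \<chi> g l\<close>.\<close>
  then have "real m = (\<Sum>i = 0..<m. \<Sum>l = 0..<N. (cmod (u i l))\<^sup>2)"
    by simp
  also have "\<dots> = (\<Sum>l = 0..<N. b l)"
    unfolding b_def by (rule sum.swap)
  also have "\<dots> = (\<Sum>l\<in>Z. b l)"
    by (rule sum.mono_neutral_right) (auto simp: Z_def b_def u_def)
  finally have sum_b: "(\<Sum>l\<in>Z. b l) = real m" ..
  have "real m \<le> (\<Sum>l\<in>Z. 1)"
    unfolding sum_b[symmetric] by (intro sum_mono b_le)
  then have "m \<le> card Z"
    by simp
  then have exists: "\<exists>S. nonvanishing_subset N \<chi> g m S"
    unfolding nonvanishing_iff by (metis obtain_subset_with_card_n)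
  have "cmod (gft \<chi> g l) =
      1 / (sqrt (real N) * sqrt (\<Sum>q = 0..<m. (cmod (gft \<chi> (unit_vec N q) l))\<^sup>2))"
    if unique: "\<exists>!S. nonvanishing_subset N \<chi> g m S"
      and S: "nonvanishing_subset N \<chi> g m S" and l: "l \<in> S" for S l
  proof -
    let ?D = "\<Sum>q = 0..<m. (cmod (gft \<chi> (unit_vec N q) l))\<^sup>2"
    \<comment> \<open>The index \<open>l\<close> witnesses that \<open>S\<close> is nonempty, so m =
      0 needs no separate treatment.\<close>
    have "S = Z"
    proof (rule unique_subset_of_card)
      show "S' = S" if "S' \<subseteq> Z" "card S' = card S" for S'
        using unique S that unfolding nonvanishing_iff by metis
    qed (use Z S l nonvanishing_iff in auto)
    then have "card Z = m" "l \<in> Z"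
      using S l nonvanishing_iff by auto
    \<comment> \<open>The terms are nonnegative by \<open>b_le\<close>, so a zero sum forces
      equality in Bessel's inequality at every index of \<open>Z\<close>.\<close>
    then have "(\<Sum>l\<in>Z. 1 - b l) = 0"
      by (simp add: sum_subtractf sum_b)
    then have "b l = 1"
      using sum_nonneg_eq_0_iff[OF Z(1), of "\<lambda>l. 1 - b l"] b_le \<open>l \<in> Z\<close> by auto
    moreover have "b l = real N * (cmod (gft \<chi> g l))\<^sup>2 * ?D"
      by (simp add: b_def u_def norm_mult power_mult_distrib sum_distrib_left mult.assoc)
    ultimately have "sqrt (real N * (cmod (gft \<chi> g l))\<^sup>2 * ?D) = 1"
      by simp
    then have "cmod (gft \<chi> g l) * (sqrt (real N) * sqrt ?D) = 1"
      by (simp add: real_sqrt_mult mult_ac)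
    \<comment> \<open>A product equal to 1 has nonzero factors, which justifies the
      division.\<close>
    then show ?thesis
      by (metis mult_zero_right nonzero_eq_divide_eq zero_neq_one)
  qed
  with exists show ?thesis
    by blast
qed

end
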